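(* Let $\xi_1^{\mathrm{dem}},\dots,\xi_{N_s}^{\mathrm{dem}}$ be demonstrations of a task given by an unknown formula $\varphi(\theta^s,\theta^p)$ with known cost function $c$, and consider the falsification algorithm described in the context. Assume: (A1) the counterexample search problem is solved with a complete planner; (A2) each demonstration is locally optimal, i.e. satisfies the KKT conditions, for fixed boolean variables; (A3) the true parameters lie in the hypothesis space of the learning problem: $\theta^p\in\Theta^p$, $\theta^s\in\Theta^s$ (and $\theta^c\in\Theta^c$ for the cost parameters). Then the falsification algorithm is guaranteed to return a formula $\varphi(\hat\theta^s,\hat\theta^p)$ such that, for all $j=1,\dots,N_s$, 1) $\xi_j^{\mathrm{dem}}\models\varphi(\hat\theta^s,\hat\theta^p)$, and 2) $\xi_j^{\mathrm{dem}}$ is globally optimal under $\varphi(\hat\theta^s,\hat\theta^p)$, 3) if such a formula exists and is representable by the provided grammar.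
   Context: **Trajectories and atomic propositions.** Consider a discrete-time system $x_{t+1}=f(x_t,u_t,t)$; a trajectory $\xi=(\xi_x,\xi_u)$ of duration $T$ consists of states $x_1,\dots,x_T$ and controls. There are $N_{AP}$ atomic propositions (APs) $p_1,\dots,p_{N_{AP}}$; with known maps $\eta_i$ from states to a constraint space $\mathcal C$ and parametric vector functions $\mathbf g_i(\cdot,\theta_i^p)=(g_{i,1},\dots,g_{i,N_i})$ (affine in $\theta^p_i$ for fixed first argument), $x\models p_i\iff\mathbf g_i(\eta_i(x),\theta_i^p)\le 0$. Put $G_i(\kappa,\theta_i^p)=\max_m g_{i,m}(\kappa,\theta_i^p)$, $\mathcal S_i(\theta_i^p)=\{\kappa: G_i(\kappa,\theta_i^p)\le 0\}$, $\mathcal A_i(\theta_i^p)=\mathrm{cl}\{\kappa:G_i(\kappa,\theta_i^p)>0\}$; boundary states may be regarded as either inside or outside the AP. Write $\theta^p=(\theta_1^p,\dots,\theta_{N_{AP}}^p)$, $\theta^p_i\in\Theta^p_i$. **Formulas.** $\varphi::=p\mid\neg p\mid\varphi_1\vee\varphi_2\mid\varphi_1\wedge\varphi_2\mid\square_{[t_1,t_2]}\varphi\mid\varphi_1\,\mathcal U_{[t_1,t_2]}\,\varphi_2$, with integers $0\le t_1\le t_2$ and $\Diamond_{[t_1,t_2]}\varphi:=\top\,\mathcal U_{[t_1,t_2]}\varphi$. Semantics on a trajectory of duration $T$ at time $t$: APs, negated APs, $\vee$, $\wedge$ as usual; $(\xi,t)\models\square_{[t_1,t_2]}\varphi$ iff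 $t+t_1\le T$ and $(\xi,\tilde t)\models\varphi$ for all $\tilde t\in[t+t_1,\min(t+t_2,T)]$; $(\xi,t)\models\varphi_1\mathcal U_{[t_1,t_2]}\varphi_2$ iff $t+t_1\le T$ and there is $\tilde t\in[t+t_1,\min(t+t_2,T)]$ with $(\xi,\tilde t)\models\varphi_2$ and $(\xi,\check t)\models\varphi_1$ for all $\check t\in[t,\tilde t-1]$ (integer times only). $\xi\models\varphi$ means $(\xi,1)\models\varphi$. The structure $\theta^s$ of a formula is a directed acyclic graph (DAG): its parse tree with identical subtrees merged, each node labelled with an AP or an operator of the grammar; its size is the number of nodes $N_{\mathrm{DAG}}$. The formula with structure $\theta^s$ and AP parameters $\theta^p$ is $\varphi(\theta^s,\theta^p)$. For a boolean matrix $\mathbf Z\in\{0,1\}^{N_{AP}\times T}$, where $Z_{i,t}=1$ requires $\eta_i(x_t)\in\mathcal S_i(\theta^p_i)$ and $Z_{i,t}=0$ requires $\eta_i(x_t)\in\mathcal A_i(\theta_i^p)$, $\Phi(\mathbf Z,\theta^p,\theta^s)\in\{0,1\}$ is the truth value of the formula when the APs take the truth values $\mathbf Z$. **Forward problem.** Minimize $c(\xi)$ subject to $\xi\models\varphi(\theta^s,\theta^p)$ and the known constraints $\bar\eta(\xi)\in\bar{\mathcal S}$ (dynamics, start state, possibly goal state); $\bar{\mathcal S}(\xi_j^{\mathrm{dem}})$ is the known set for demonstration $j$. Each demonstration $\xi_j^{\mathrm{dem}}$ (duration $T_j$) is feasible for the forward problem with the true parameters and satisfies $c(\xi_j^{\mathrm{dem}})\le(1+\delta)c(\xi_j^*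 )$ for a known $\delta$, where $\xi_j^*$ is a global optimum. A demonstration is globally optimal under a formula if it minimizes $c$ among all trajectories satisfying that formula and the known constraints of that demonstration. **KKT conditions for fixed booleans, $\mathrm{KKT}_{LTL}(\xi_j^{\mathrm{dem}})$.** Write the known constraints at time $t$ as $\mathbf h^k(\eta(x_t^j))=0$, $\mathbf g^k(\eta(x_t^j))\le0$. The conditions on $(\theta^p,\mathbf Z^j,\mathbf s^j,\lambda,\nu)$, with $\mathbf s_{i,t}^j\in\{0,1\}^{N_i}$, are, for all $i,t$ (with $\kappa_t^j=\eta_i(x_t^j)$): (i) primal feasibility: known constraints hold; $s_{i,m,t}^j=1\Rightarrow g_{i,m}(\kappa_t^j,\theta_i^p)\le0$, $s_{i,m,t}^j=0\Rightarrow g_{i,m}(\kappa_t^j,\theta^p_i)\ge0$, and $Z_{i,t}^j=1$ iff $s_{i,m,t}^j=1$ for all $m$; (ii) multipliers $\lambda_t^{j,k}\ge0$, $\lambda_{i,t}^{j,\neg k}\ge0$; (iii) complementary slackness: $\lambda_t^{j,k}\odot\mathbf g^k(\eta(x_t^j))=0$, $\lambda_{i,t}^{j,\neg k}\odot\mathbf g_i(\kappa_t^j,\theta_i^p)=0$ ($\odot$ is the elementwise product); (iv) stationarity: $\nabla_{x_t}c(\xi_j^{\mathrm{dem}})+(\lambda_t^{j,k})^\top\nabla_{x_t}\mathbf g^k(\eta(x_t^j))+\sum_{i=1}^{N_{AP}}\big(\lambda_{i,t}^{j,\neg k}\odot(2\mathbf s_{i,t}^j-\mathbf 1)\big)^\top\nabla_{x_t}\mathbf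 g_i(\eta_i(x_t^j),\theta_i^p)+(\nu_t^{j,k})^\top\nabla_{x_t}\mathbf h^k(\eta(x_t^j))=0$. **Learning problem with size $N_{\mathrm{DAG}}$ and counterexample set $E$.** Find a well-formed DAG $\hat\theta^s$ with $N_{\mathrm{DAG}}$ nodes, $\hat\theta^p\in\Theta^p$, and $\lambda,\nu,\mathbf s^j,\mathbf Z^j$ such that for every $j$: $\mathrm{KKT}_{LTL}(\xi_j^{\mathrm{dem}})$ holds and $\Phi(\mathbf Z^j,\hat\theta^p,\hat\theta^s)=1$; and every trajectory in $E$ fails to satisfy $\varphi(\hat\theta^s,\hat\theta^p)$. **Counterexample search for demonstration $j$.** Find $\xi$ with $\xi\models\varphi(\hat\theta^s,\hat\theta^p)$, $\bar\eta(\xi)\in\bar{\mathcal S}(\xi_j^{\mathrm{dem}})$, $c(\xi)<c(\xi_j^{\mathrm{dem}})/(1+\delta)$. **Falsification algorithm.** Start with $N_{\mathrm{DAG}}=0$, $E=\emptyset$. Outer loop: increase $N_{\mathrm{DAG}}$ by 1. Inner loop: while the learning problem with current $N_{\mathrm{DAG}},E$ is feasible, take a solution $(\hat\theta^s,\hat\theta^p)$ and solve the counterexample search for each $j$; add every counterexample found to $E$; if no counterexample is found for any $j$, stop and return $\varphi(\hat\theta^s,\hat\theta^p)$. When the learning problem becomes infeasible, go back to the outer loop.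
   Formalization: Adds that only finitely many counterexamples are collected at each size N_DAG (otherwise the inner loop can run forever), and concludes global optimality only for δ = 0; for δ > 0 (δ ≥ 0 is assumed) it concludes optimality up to the factor 1+δ, since exact optimality can fail. *)

theory Defs
  imports "HOL-Analysis.Analysis"
begin

section \<open>Formula structures\<close>

text \<open>
  Atomic propositions are numbered from \<open>0\<close>. The constant \<open>Top\<close> is only there to express the
  abbreviation \<open>Diamond\<close>; \<open>well_formed\<close> admits it nowhere else.
\<close>

datatype formula =
    Top
  | AP nat
  | NegAP nat
  | Or formula formula
  | And formula formula
  | Always nat nat formula
  | Until nat nat formula formula

abbreviation Diamond :: "nat \<Rightarrow> nat \<Rightarrow> formula \<Rightarrow> formula" where
  "Diamond t1 t2 \<phi> \<equiv> Until t1 t2 Top \<phi>"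

fun well_formed :: "nat \<Rightarrow> formula \<Rightarrow> bool" where
  "well_formed n Top \<longleftrightarrow> False"
| "well_formed n (AP i) \<longleftrightarrow> i < n"
| "well_formed n (NegAP i) \<longleftrightarrow> i < n"
| "well_formed n (Or \<phi> \<psi>) \<longleftrightarrow> well_formed n \<phi> \<and> well_formed n \<psi>"
| "well_formed n (And \<phi> \<psi>) \<longleftrightarrow> well_formed n \<phi> \<and> well_formed n \<psi>"
| "well_formed n (Always t1 t2 \<phi>) \<longleftrightarrow> t1 \<le> t2 \<and> well_formed n \<phi>"
| "well_formed n (Until t1 t2 \<phi> \<psi>) \<longleftrightarrow>
     t1 \<le> t2 \<and> (\<phi> = Top \<or> well_formed n \<phi>) \<and> well_formed n \<psi>"

text \<open>
  Merging identical subtrees of the parse tree leaves one DAG node per distinct subformula. A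
  negated proposition consists of a negation node with the proposition below it.
\<close>

fun dag_nodes :: "formula \<Rightarrow> formula set" where
  "dag_nodes Top = {Top}"
| "dag_nodes (AP i) = {AP i}"
| "dag_nodes (NegAP i) = {NegAP i, AP i}"
| "dag_nodes (Or \<phi> \<psi>) = insert (Or \<phi> \<psi>) (dag_nodes \<phi> \<union> dag_nodes \<psi>)"
| "dag_nodes (And \<phi> \<psi>) = insert (And \<phi> \<psi>) (dag_nodes \<phi> \<union> dag_nodes \<psi>)"
| "dag_nodes (Always t1 t2 \<phi>) = insert (Always t1 t2 \<phi>) (dag_nodes \<phi>)"
| "dag_nodes (Until t1 t2 \<phi> \<psi>) = insert (Until t1 t2 \<phi> \<psi>) (dag_nodes \<phi> \<union> dag_nodes \<psi>)"

definition dag_size :: "formula \<Rightarrow> nat" where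
  "dag_size \<phi> = card (dag_nodes \<phi>)"

text \<open>
  Truth at time \<open>t\<close> on a horizon \<open>{1..T}\<close>, where \<open>Z i t\<close> is the truth value of proposition \<open>i\<close> at
  time \<open>t\<close>.
\<close>

fun holds_at :: "(nat \<Rightarrow> nat \<Rightarrow> bool) \<Rightarrow> nat \<Rightarrow> nat \<Rightarrow> formula \<Rightarrow> bool" where
  "holds_at Z T t Top \<longleftrightarrow> True"
| "holds_at Z T t (AP i) \<longleftrightarrow> Z i t"
| "holds_at Z T t (NegAP i) \<longleftrightarrow> \<not> Z i t"
| "holds_at Z T t (Or \<phi> \<psi>) \<longleftrightarrow> holds_at Z T t \<phi> \<or> holds_at Z T t \<psi>"
| "holds_at Z T t (And \<phi> \<psi>) \<longleftrightarrow> holds_at Z T t \<phi> \<and> holds_at Z T t \<psi>"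
| "holds_at Z T t (Always t1 t2 \<phi>) \<longleftrightarrow>
     t + t1 \<le> T \<and> (\<forall>t' \<in> {t + t1..min (t + t2) T}. holds_at Z T t' \<phi>)"
| "holds_at Z T t (Until t1 t2 \<phi> \<psi>) \<longleftrightarrow>
     t + t1 \<le> T \<and>
     (\<exists>t' \<in> {t + t1..min (t + t2) T}.
        holds_at Z T t' \<psi> \<and> (\<forall>t'' \<in> {t..<t'}. holds_at Z T t'' \<phi>))"

definition Phi :: "(nat \<Rightarrow> nat \<Rightarrow> bool) \<Rightarrow> nat \<Rightarrow> formula \<Rightarrow> bool" where
  "Phi Z T \<phi> \<longleftrightarrow> holds_at Z T 1 \<phi>"


section \<open>Trajectories and tasks\<close>

text \<open>Times run from \<open>1\<close>: the state \<open>x\<^sub>t\<close> is the list element with index \<open>t - 1\<close>.\<close>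

datatype ('x, 'u) traj = Traj (states: "'x list") (controls: "'u list")

definition duration :: "('x, 'u) traj \<Rightarrow> nat" where
  "duration \<xi> = length (states \<xi>)"

definition state_at :: "('x, 'u) traj \<Rightarrow> nat \<Rightarrow> 'x" where
  "state_at \<xi> t = states \<xi> ! (t - 1)"

definition control_at :: "('x, 'u) traj \<Rightarrow> nat \<Rightarrow> 'u" where
  "control_at \<xi> t = controls \<xi> ! (t - 1)"

definition with_state :: "('x, 'u) traj \<Rightarrow> nat \<Rightarrow> 'x \<Rightarrow> ('x, 'u) traj" where
  "with_state \<xi> t y = Traj ((states \<xi>)[t - 1 := y]) (controls \<xi>)"

text \<open>
  Types: \<open>'x\<close> states, \<open>'u\<close> controls, \<open>'c\<close> the constraint space of the propositions, \<open>'p\<close> the space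
  containing every \<open>\<theta>\<^sub>i\<^sup>p\<close>, \<open>'k\<close> the range of \<open>\<eta>\<close>, and \<open>'b\<close> the range of \<open>\<eta>\<close>-bar. A vector function is
  the list of its components. The argument of \<open>known_set\<close> and the first argument of \<open>known_ineq\<close>
  and \<open>known_eq\<close> is the index of a demonstration (start and goal may differ between
  demonstrations); their second argument is the time.
\<close>

record ('x, 'u, 'c, 'p, 'k, 'b) task =
  num_APs :: nat
  ap_map :: "nat \<Rightarrow> 'x \<Rightarrow> 'c"
  ap_constr :: "nat \<Rightarrow> ('c \<Rightarrow> 'p \<Rightarrow> real) list"
  ap_params :: "nat \<Rightarrow> 'p set"
  dynamics :: "'x \<Rightarrow> 'u \<Rightarrow> nat \<Rightarrow> 'x"
  cost :: "('x, 'u) traj \<Rightarrow> real"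
  known_map :: "'x \<Rightarrow> 'k"
  known_ineq :: "nat \<Rightarrow> nat \<Rightarrow> ('k \<Rightarrow> real) list"
  known_eq :: "nat \<Rightarrow> nat \<Rightarrow> ('k \<Rightarrow> real) list"
  known_traj_map :: "('x, 'u) traj \<Rightarrow> 'b"
  known_set :: "nat \<Rightarrow> 'b set"
  demos :: "('x, 'u) traj list"
  slack :: real  \<comment> \<open>the suboptimality bound \<open>\<delta>\<close>\<close>

definition num_demos :: "('x, 'u, 'c, 'p, 'k, 'b) task \<Rightarrow> nat" where
  "num_demos P = length (demos P)"

definition demo :: "('x, 'u, 'c, 'p, 'k, 'b) task \<Rightarrow> nat \<Rightarrow> ('x, 'u) traj" where
  "demo P j = demos P ! j"

definition Theta_s :: "('x, 'u, 'c, 'p, 'k, 'b) task \<Rightarrow> formula set" where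
  "Theta_s P = {\<phi>. well_formed (num_APs P) \<phi>}"

definition Theta_p :: "('x, 'u, 'c, 'p, 'k, 'b) task \<Rightarrow> (nat \<Rightarrow> 'p) set" where
  "Theta_p P = {\<theta>. \<forall>i < num_APs P. \<theta> i \<in> ap_params P i}"

definition num_constr :: "('x, 'u, 'c, 'p, 'k, 'b) task \<Rightarrow> nat \<Rightarrow> nat" where
  "num_constr P i = length (ap_constr P i)"

definition ap_g :: "('x, 'u, 'c, 'p, 'k, 'b) task \<Rightarrow> nat \<Rightarrow> nat \<Rightarrow> 'c \<Rightarrow> 'p \<Rightarrow> real" where
  "ap_g P i m = ap_constr P i ! m"

definition ap_G :: "('x, 'u, 'c, 'p, 'k, 'b) task \<Rightarrow> nat \<Rightarrow> 'c \<Rightarrow> 'p \<Rightarrow> real" where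
  "ap_G P i \<kappa> \<theta> = Max ((\<lambda>m. ap_g P i m \<kappa> \<theta>) ` {..<num_constr P i})"

definition ap_inside :: "('x, 'u, 'c, 'p, 'k, 'b) task \<Rightarrow> nat \<Rightarrow> 'p \<Rightarrow> 'c set" where
  "ap_inside P i \<theta> = {\<kappa>. ap_G P i \<kappa> \<theta> \<le> 0}"

definition ap_outside ::
  "('x, 'u, 'c::topological_space, 'p, 'k, 'b) task \<Rightarrow> nat \<Rightarrow> 'p \<Rightarrow> 'c set" where
  "ap_outside P i \<theta> = closure {\<kappa>. ap_G P i \<kappa> \<theta> > 0}"

text \<open>
  A boolean matrix is a labelling of \<open>\<xi>\<close> if it puts every state inside or outside of each
  proposition. A state in the interior of either side has only one label; a boundary state, lying
  in both \<open>ap_inside\<close> and \<open>ap_outside\<close>, may get either label. Satisfaction, in \<open>sat\<close>, means truth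
  under some labelling.
\<close>

definition labelling ::
  "('x, 'u, 'c::topological_space, 'p, 'k, 'b) task \<Rightarrow> (nat \<Rightarrow> 'p) \<Rightarrow> ('x, 'u) traj \<Rightarrow>
   (nat \<Rightarrow> nat \<Rightarrow> bool) \<Rightarrow> bool" where
  "labelling P \<theta> \<xi> Z \<longleftrightarrow>
     (\<forall>i < num_APs P. \<forall>t \<in> {1..duration \<xi>}.
        (Z i t \<longrightarrow> ap_map P i (state_at \<xi> t) \<in> ap_inside P i (\<theta> i)) \<and>
        (\<not> Z i t \<longrightarrow> ap_map P i (state_at \<xi> t) \<in> ap_outside P i (\<theta> i)))"

definition sat ::
  "('x, 'u, 'c::topological_space, 'p, 'k, 'b) task \<Rightarrow> ('x, 'u) traj \<Rightarrow> formula \<Rightarrow> (nat \<Rightarrow> 'p) \<Rightarrow>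
   bool" where
  "sat P \<xi> \<phi> \<theta> \<longleftrightarrow> 1 \<le> duration \<xi> \<and> (\<exists>Z. labelling P \<theta> \<xi> Z \<and> Phi Z (duration \<xi>) \<phi>)"

definition known_feasible ::
  "('x, 'u, 'c, 'p, 'k, 'b) task \<Rightarrow> nat \<Rightarrow> ('x, 'u) traj \<Rightarrow> bool" where
  "known_feasible P j \<xi> \<longleftrightarrow> known_traj_map P \<xi> \<in> known_set P j"

definition follows_dynamics ::
  "('x, 'u, 'c, 'p, 'k, 'b) task \<Rightarrow> ('x, 'u) traj \<Rightarrow> bool" where
  "follows_dynamics P \<xi> \<longleftrightarrow>
     duration \<xi> \<le> length (controls \<xi>) + 1 \<and>
     (\<forall>t. 1 \<le> t \<and> t < duration \<xi> \<longrightarrow>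
        state_at \<xi> (t + 1) = dynamics P (state_at \<xi> t) (control_at \<xi> t) t)"

definition known_constraints_at ::
  "('x, 'u, 'c, 'p, 'k, 'b) task \<Rightarrow> nat \<Rightarrow> nat \<Rightarrow> 'x \<Rightarrow> bool" where
  "known_constraints_at P j t x \<longleftrightarrow>
     (\<forall>h \<in> set (known_eq P j t). h (known_map P x) = 0) \<and>
     (\<forall>g \<in> set (known_ineq P j t). g (known_map P x) \<le> 0)"

definition optimal_within ::
  "('x, 'u, 'c::topological_space, 'p, 'k, 'b) task \<Rightarrow> real \<Rightarrow> nat \<Rightarrow> ('x, 'u) traj \<Rightarrow>
   formula \<Rightarrow> (nat \<Rightarrow> 'p) \<Rightarrow> bool" where
  "optimal_within P \<delta> j \<xi> \<phi> \<theta> \<longleftrightarrow>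
     sat P \<xi> \<phi> \<theta> \<and> known_feasible P j \<xi> \<and>
     (\<forall>\<xi>'. sat P \<xi>' \<phi> \<theta> \<and> known_feasible P j \<xi>' \<longrightarrow> cost P \<xi> \<le> (1 + \<delta>) * cost P \<xi>')"

definition globally_optimal ::
  "('x, 'u, 'c::topological_space, 'p, 'k, 'b) task \<Rightarrow> nat \<Rightarrow> ('x, 'u) traj \<Rightarrow>
   formula \<Rightarrow> (nat \<Rightarrow> 'p) \<Rightarrow> bool" where
  "globally_optimal P j \<xi> \<phi> \<theta> \<longleftrightarrow>
     sat P \<xi> \<phi> \<theta> \<and> known_feasible P j \<xi> \<and>
     (\<forall>\<xi>'. sat P \<xi>' \<phi> \<theta> \<and> known_feasible P j \<xi>' \<longrightarrow> cost P \<xi> \<le> cost P \<xi>')"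


section \<open>KKT conditions for fixed booleans\<close>

text \<open>Meaningful only where \<open>f\<close> is differentiable; \<open>regular_task\<close> ensures this where it is used.\<close>

definition gradient :: "('a::euclidean_space \<Rightarrow> real) \<Rightarrow> 'a \<Rightarrow> 'a" where
  "gradient f x = (THE D. GDERIV f x :> D)"

text \<open>
  \<open>lamK t l\<close>, \<open>lamA i t m\<close> and \<open>nu t l\<close> are the components of the multipliers
  \<open>\<lambda>\<^sub>t\<^sup>j\<^sup>,\<^sup>k\<close>, \<open>\<lambda>\<^sub>i\<^sub>,\<^sub>t\<close> (of the propositions) and \<open>\<nu>\<^sub>t\<^sup>j\<^sup>,\<^sup>k\<close>.
\<close>

definition KKT_LTL ::
  "('x::euclidean_space, 'u, 'c, 'p, 'k, 'b) task \<Rightarrow> nat \<Rightarrow> ('x, 'u) traj \<Rightarrow> (nat \<Rightarrow> 'p) \<Rightarrow>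
   (nat \<Rightarrow> nat \<Rightarrow> bool) \<Rightarrow> (nat \<Rightarrow> nat \<Rightarrow> nat \<Rightarrow> bool) \<Rightarrow>
   (nat \<Rightarrow> nat \<Rightarrow> real) \<Rightarrow> (nat \<Rightarrow> nat \<Rightarrow> nat \<Rightarrow> real) \<Rightarrow> (nat \<Rightarrow> nat \<Rightarrow> real) \<Rightarrow> bool" where
  "KKT_LTL P j \<xi> \<theta> Z s lamK lamA nu \<longleftrightarrow>
     (\<forall>t \<in> {1..duration \<xi>}.
        let x = state_at \<xi> t; gs = known_ineq P j t; hs = known_eq P j t in
        known_constraints_at P j t x \<and>
        (\<forall>i < num_APs P.
           (\<forall>m < num_constr P i.
              (s i m t \<longrightarrow> ap_g P i m (ap_map P i x) (\<theta> i) \<le> 0) \<and>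
              (\<not> s i m t \<longrightarrow> ap_g P i m (ap_map P i x) (\<theta> i) \<ge> 0)) \<and>
           (Z i t \<longleftrightarrow> (\<forall>m < num_constr P i. s i m t))) \<and>
        (\<forall>l < length gs. lamK t l \<ge> 0) \<and>
        (\<forall>i < num_APs P. \<forall>m < num_constr P i. lamA i t m \<ge> 0) \<and>
        (\<forall>l < length gs. lamK t l * (gs ! l) (known_map P x) = 0) \<and>
        (\<forall>i < num_APs P. \<forall>m < num_constr P i.
           lamA i t m * ap_g P i m (ap_map P i x) (\<theta> i) = 0) \<and>
        gradient (\<lambda>y. cost P (with_state \<xi> t y)) x
        + (\<Sum>l < length gs. lamK t l *\<^sub>R gradient (\<lambda>y. (gs ! l) (known_map P y)) x)
        + (\<Sum>i < num_APs P. \<Sum>m < num_constr P i.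
             (lamA i t m * (2 * of_bool (s i m t) - 1)) *\<^sub>R
             gradient (\<lambda>y. ap_g P i m (ap_map P i y) (\<theta> i)) x)
        + (\<Sum>l < length hs. nu t l *\<^sub>R gradient (\<lambda>y. (hs ! l) (known_map P y)) x)
        = 0)"

text \<open>
  Standing conventions on a task: propositions have at least one constraint, each affine in the
  parameter; membership in the known set entails the dynamics and the constraints
  \<open>known_eq\<close> and \<open>known_ineq\<close> that enter the KKT conditions; and the functions whose gradients
  occur there are differentiable at the demonstrations.
\<close>

definition regular_task ::
  "('x::euclidean_space, 'u, 'c, 'p::real_vector, 'k, 'b) task \<Rightarrow> bool" where
  "regular_task P \<longleftrightarrow>
     (\<forall>i < num_APs P. num_constr P i \<ge> 1 \<and>
        (\<forall>m < num_constr P i. \<forall>\<kappa>. \<exists>L b. linear L \<and> (\<forall>\<theta>. ap_g P i m \<kappa> \<theta> = L \<theta> + b))) \<and>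
     (\<forall>j < num_demos P. \<forall>\<xi>. known_feasible P j \<xi> \<longrightarrow>
        follows_dynamics P \<xi> \<and>
        (\<forall>t \<in> {1..duration \<xi>}. known_constraints_at P j t (state_at \<xi> t))) \<and>
     (\<forall>j < num_demos P. \<forall>t \<in> {1..duration (demo P j)}.
        let x = state_at (demo P j) t in
        (\<lambda>y. cost P (with_state (demo P j) t y)) differentiable (at x) \<and>
        (\<forall>g \<in> set (known_ineq P j t) \<union> set (known_eq P j t).
           (\<lambda>y. g (known_map P y)) differentiable (at x)) \<and>
        (\<forall>i < num_APs P. \<forall>m < num_constr P i. \<forall>\<theta> \<in> ap_params P i.
           (\<lambda>y. ap_g P i m (ap_map P i y) \<theta>) differentiable (at x)))"


section \<open>The falsification algorithm\<close>

definition learning_solution ::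
  "('x::euclidean_space, 'u, 'c::topological_space, 'p, 'k, 'b) task \<Rightarrow> nat \<Rightarrow>
   ('x, 'u) traj set \<Rightarrow> formula \<Rightarrow> (nat \<Rightarrow> 'p) \<Rightarrow> bool" where
  "learning_solution P N E \<phi> \<theta> \<longleftrightarrow>
     \<phi> \<in> Theta_s P \<and> dag_size \<phi> = N \<and> \<theta> \<in> Theta_p P \<and>
     (\<forall>j < num_demos P. \<exists>Z s lamK lamA nu.
        labelling P \<theta> (demo P j) Z \<and> KKT_LTL P j (demo P j) \<theta> Z s lamK lamA nu \<and>
        Phi Z (duration (demo P j)) \<phi>) \<and>
     (\<forall>\<xi> \<in> E. \<not> sat P \<xi> \<phi> \<theta>)"

definition counterexample ::
  "('x, 'u, 'c::topological_space, 'p, 'k, 'b) task \<Rightarrow> formula \<Rightarrow> (nat \<Rightarrow> 'p) \<Rightarrow> nat \<Rightarrow>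
   ('x, 'u) traj \<Rightarrow> bool" where
  "counterexample P \<phi> \<theta> j \<xi> \<longleftrightarrow>
     sat P \<xi> \<phi> \<theta> \<and> known_feasible P j \<xi> \<and> cost P \<xi> < cost P (demo P j) / (1 + slack P)"

text \<open>
  A planner is given by its possible answers: \<open>planner \<phi> \<theta> j r\<close> says that \<open>r\<close> is a possible answer to
  the counterexample search for demonstration \<open>j\<close>, where \<open>None\<close> stands for ``nothing found''. Being a
  relation, it may answer the same query differently at different moments.
\<close>

type_synonym ('x, 'u, 'p) planner =
  "formula \<Rightarrow> (nat \<Rightarrow> 'p) \<Rightarrow> nat \<Rightarrow> ('x, 'u) traj option \<Rightarrow> bool"

definition complete_planner ::
  "('x, 'u, 'c::topological_space, 'p, 'k, 'b) task \<Rightarrow> ('x, 'u, 'p) planner \<Rightarrow> bool" where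
  "complete_planner P planner \<longleftrightarrow>
     (\<forall>\<phi> \<theta> j. j < num_demos P \<longrightarrow>
        (\<exists>r. planner \<phi> \<theta> j r) \<and>
        (\<forall>\<xi>. planner \<phi> \<theta> j (Some \<xi>) \<longrightarrow> counterexample P \<phi> \<theta> j \<xi>) \<and>
        (planner \<phi> \<theta> j None \<longrightarrow> (\<nexists>\<xi>. counterexample P \<phi> \<theta> j \<xi>)))"

text \<open>
  \<open>Outer N E\<close> and \<open>Inner N E\<close> are the heads of the two loops, with current size \<open>N\<close> and set \<open>E\<close> of
  counterexamples. The learner may pick any solution of the learning problem.
\<close>

datatype ('x, 'u, 'p) alg_state =
    Outer nat "('x, 'u) traj set"
  | Inner nat "('x, 'u) traj set"
  | Returned formula "nat \<Rightarrow> 'p"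

inductive alg_step ::
  "('x::euclidean_space, 'u, 'c::topological_space, 'p, 'k, 'b) task \<Rightarrow> ('x, 'u, 'p) planner \<Rightarrow>
   ('x, 'u, 'p) alg_state \<Rightarrow> ('x, 'u, 'p) alg_state \<Rightarrow> bool"
  for P planner where
  grow: "alg_step P planner (Outer N E) (Inner (N + 1) E)"
| infeasible: "(\<nexists>\<phi> \<theta>. learning_solution P N E \<phi> \<theta>) \<Longrightarrow>
     alg_step P planner (Inner N E) (Outer N E)"
| refine: "\<lbrakk>learning_solution P N E \<phi> \<theta>; \<forall>j < num_demos P. planner \<phi> \<theta> j (r j);
     \<exists>j < num_demos P. r j \<noteq> None\<rbrakk> \<Longrightarrow>
     alg_step P planner (Inner N E) (Inner N (E \<union> {\<xi>. \<exists>j < num_demos P. r j = Some \<xi>}))"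
| accept: "\<lbrakk>learning_solution P N E \<phi> \<theta>; \<forall>j < num_demos P. planner \<phi> \<theta> j None\<rbrakk> \<Longrightarrow>
     alg_step P planner (Inner N E) (Returned \<phi> \<theta>)"

text \<open>
  Maximal runs, as infinite sequences: a run that cannot continue repeats its last state. So a
  deadlock before \<open>Returned\<close> would also be a run.
\<close>

definition alg_run ::
  "('x::euclidean_space, 'u, 'c::topological_space, 'p, 'k, 'b) task \<Rightarrow> ('x, 'u, 'p) planner \<Rightarrow>
   (nat \<Rightarrow> ('x, 'u, 'p) alg_state) \<Rightarrow> bool" where
  "alg_run P planner \<sigma> \<longleftrightarrow>
     \<sigma> 0 = Outer 0 {} \<and>
     (\<forall>n. alg_step P planner (\<sigma> n) (\<sigma> (Suc n)) \<or>
          (\<nexists>q. alg_step P planner (\<sigma> n) q) \<and> \<sigma> (Suc n) = \<sigma> n)"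

text \<open>All trajectories that are in the counterexample set at some moment of size \<open>N\<close>.\<close>

definition collected :: "(nat \<Rightarrow> ('x, 'u, 'p) alg_state) \<Rightarrow> nat \<Rightarrow> ('x, 'u) traj set" where
  "collected \<sigma> N = \<Union>{E. \<exists>n. \<sigma> n = Inner N E}"

end

theory Submission
  imports Defs
begin

text \<open>
  A counterexample for demonstration \<open>j\<close> is cheaper than the optimum of the true forward problem, so
  it violates the true formula. Hence the true formula stays feasible for the learning problem of
  its own size, and the outer loop never grows beyond that size. In the inner loop each refinement
  adds a trajectory outside the current set \<open>E\<close>, because the learned formula is satisfied by the new
  trajectory and by none in \<open>E\<close>; as only finitely many are collected per size, the loop terminates.
\<close>

lemma finite_dag_nodes: "finite (dag_nodes \<phi>)"
  by (induction \<phi>) auto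

lemma dag_size_pos: "dag_size \<phi> > 0"
proof -
  have "dag_nodes \<phi> \<noteq> {}" by (cases \<phi>) auto
  then show ?thesis by (simp add: dag_size_def card_gt_0_iff finite_dag_nodes)
qed

lemma optimal_within_0: "optimal_within P 0 j \<xi> \<phi> \<theta> \<longleftrightarrow> globally_optimal P j \<xi> \<phi> \<theta>"
  by (simp add: optimal_within_def globally_optimal_def)

text \<open>The cost threshold of the search is the bound in \<open>optimal_within\<close> divided
  by \<open>1 + slack P\<close>, a positive number.\<close>

lemma optimal_within_iff_no_counterexample:
  assumes "slack P > -1" "sat P (demo P j) \<phi> \<theta>" "known_feasible P j (demo P j)"
  shows "optimal_within P (slack P) j (demo P j) \<phi> \<theta> \<longleftrightarrow> (\<nexists>\<xi>. counterexample P \<phi> \<theta> j \<xi>)"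
proof -
  have "cost P (demo P j) \<le> (1 + slack P) * c \<longleftrightarrow> \<not> c < cost P (demo P j) / (1 + slack P)" for c
    using assms(1) by (simp add: pos_divide_le_eq mult.commute not_less)
  then show ?thesis
    using assms(2,3) by (auto simp: optimal_within_def counterexample_def)
qed

text \<open>Only the cost and known feasibility of the counterexample matter, so the learned pair
  \<phi>', \<theta>' is arbitrary.\<close>

lemma counterexample_not_sat:
  assumes "slack P > -1"
    and "globally_optimal P j \<xi>' \<phi> \<theta>" "cost P (demo P j) \<le> (1 + slack P) * cost P \<xi>'"
    and "counterexample P \<phi>' \<theta>' j \<xi>"
  shows "\<not> sat P \<xi> \<phi> \<theta>"
proof
  assume "sat P \<xi> \<phi> \<theta>"
  with assms(2,4) have "cost P \<xi>' \<le> cost P \<xi>"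
    by (auto simp: globally_optimal_def counterexample_def)
  also have "\<dots> < cost P (demo P j) / (1 + slack P)"
    using assms(4) by (simp add: counterexample_def)
  also have "\<dots> \<le> cost P \<xi>'"
    using assms(1,3) by (simp add: pos_divide_le_eq mult.commute)
  finally show False by simp
qed

lemma learning_solution_imp_sat:
  assumes "learning_solution P N E \<phi> \<theta>" "j < num_demos P" "1 \<le> duration (demo P j)"
  shows "sat P (demo P j) \<phi> \<theta>"
  using assms by (auto simp: learning_solution_def sat_def)

text \<open>Rules out deadlock: each loop head has a rule for every outcome, and a complete planner
  answers every query.\<close>

lemma alg_step_exists:
  assumes "complete_planner P planner" "\<nexists>\<phi> \<theta>. s = Returned \<phi> \<theta>"
  shows "\<exists>q. alg_step P planner s q"
proof (cases s)
  case (Outer N E)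
  then show ?thesis by (blast intro: alg_step.grow)
next
  case (Inner N E)
  show ?thesis
  proof (cases "\<exists>\<phi> \<theta>. learning_solution P N E \<phi> \<theta>")
    case True
    then obtain \<phi> \<theta> where sol: "learning_solution P N E \<phi> \<theta>" by blast
    \<comment> \<open>The bound on \<open>j\<close> stands below the existential so that choice
      yields a total function \<open>r\<close> of answers.\<close>
    have "\<forall>j. \<exists>r. j < num_demos P \<longrightarrow> planner \<phi> \<theta> j r"
      using assms(1) by (auto simp: complete_planner_def)
    then obtain r where r: "\<forall>j < num_demos P. planner \<phi> \<theta> j (r j)"
      by metis
    show ?thesis
    proof (cases "\<exists>j < num_demos P. r j \<noteq> None")
      case True
      then show ?thesis using Inner sol r alg_step.refine by blast
    next
      case False
      then have "\<forall>j < num_demos P. planner \<phi> \<theta> j None" using r by auto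
      then show ?thesis using Inner sol alg_step.accept by blast
    qed
  next
    case False
    then show ?thesis using Inner alg_step.infeasible by blast
  qed
next
  case (Returned \<phi> \<theta>)
  then show ?thesis using assms(2) by blast
qed

lemma alg_run_step:
  assumes "alg_run P planner \<sigma>" "complete_planner P planner" "\<nexists>\<phi> \<theta>. \<sigma> n = Returned \<phi> \<theta>"
  shows "alg_step P planner (\<sigma> n) (\<sigma> (Suc n))"
  using assms alg_step_exists[OF assms(2,3)] by (auto simp: alg_run_def)

text \<open>Invariant of a run, used with the true formula as \<phi>, \<theta>. The bound at
  \<open>Outer\<close> is strict because \<open>grow\<close> is about to add one to the
  size.\<close>

fun sound_state ::
  "('x::euclidean_space, 'u, 'c::topological_space, 'p, 'k, 'b) task \<Rightarrow> formula \<Rightarrow> (nat \<Rightarrow> 'p) \<Rightarrow>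
   ('x, 'u, 'p) alg_state \<Rightarrow> bool" where
  "sound_state P \<phi> \<theta> (Outer N E) \<longleftrightarrow> N < dag_size \<phi> \<and> (\<forall>\<xi> \<in> E. \<not> sat P \<xi> \<phi> \<theta>)"
| "sound_state P \<phi> \<theta> (Inner N E) \<longleftrightarrow> N \<le> dag_size \<phi> \<and> (\<forall>\<xi> \<in> E. \<not> sat P \<xi> \<phi> \<theta>)"
| "sound_state P \<phi> \<theta> (Returned \<phi>' \<theta>') \<longleftrightarrow>
     (\<exists>N E. learning_solution P N E \<phi>' \<theta>') \<and>
     (\<forall>j < num_demos P. \<nexists>\<xi>. counterexample P \<phi>' \<theta>' j \<xi>)"

lemma sound_state_step:
  assumes step: "alg_step P planner s s'" and "sound_state P \<phi> \<theta> s"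
    and planner: "complete_planner P planner"
    and feasible: "\<And>E. \<forall>\<xi> \<in> E. \<not> sat P \<xi> \<phi> \<theta> \<Longrightarrow> learning_solution P (dag_size \<phi>) E \<phi> \<theta>"
    and not_sat: "\<And>\<phi>' \<theta>' j \<xi>. \<lbrakk>j < num_demos P; counterexample P \<phi>' \<theta>' j \<xi>\<rbrakk> \<Longrightarrow> \<not> sat P \<xi> \<phi> \<theta>"
  shows "sound_state P \<phi> \<theta> s'"
  using step assms(2)
proof cases
  case (infeasible N E)
  \<comment> \<open>At its own size the true formula would itself be a solution, so infeasibility
    gives the strict bound required at \<open>Outer\<close>.\<close>
  then have "N \<noteq> dag_size \<phi>" using feasible assms(2) by auto
  then show ?thesis using infeasible assms(2) by simp
next
  case (refine N E \<phi>' \<theta>' r)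
  have "\<not> sat P \<xi> \<phi> \<theta>" if "j < num_demos P" "r j = Some \<xi>" for j \<xi>
  proof -
    have "planner \<phi>' \<theta>' j (Some \<xi>)" using that refine by metis
    then show ?thesis using planner that(1) not_sat unfolding complete_planner_def by blast
  qed
  then show ?thesis using refine assms(2) by auto
next
  case (accept N E \<phi>' \<theta>')
  then show ?thesis using planner by (auto simp: complete_planner_def)
qed auto

text \<open>
  Decreases lexicographically along a run, where \<open>M\<close> bounds the sizes and \<open>C N\<close> contains the
  trajectories that are ever collected at size \<open>N\<close>.
\<close>

fun rank :: "nat \<Rightarrow> (nat \<Rightarrow> ('x, 'u) traj set) \<Rightarrow> ('x, 'u, 'p) alg_state \<Rightarrow> nat \<times> nat" where
  "rank M C (Outer N E) = (M - N, 0)"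
| "rank M C (Inner N E) = (M - N, Suc (card (C N - E)))"
| "rank M C (Returned \<phi> \<theta>) = (0, 0)"

lemma rank_step:
  assumes step: "alg_step P planner s s'" and "sound_state P \<phi> \<theta> s"
    and planner: "complete_planner P planner"
    and fin: "\<And>N. finite (C N)" and coll: "\<And>N E. s' = Inner N E \<Longrightarrow> E \<subseteq> C N"
    and running: "\<nexists>\<phi>' \<theta>'. s' = Returned \<phi>' \<theta>'"
  shows "(rank (dag_size \<phi>) C s', rank (dag_size \<phi>) C s) \<in> less_than <*lex*> less_than"
  using step
proof cases
  case (grow N E)
  \<comment> \<open>The subtraction in \<open>rank\<close> is truncated; it drops because the
    invariant gives \<open>N < dag_size \<phi>\<close>.\<close>
  then show ?thesis using assms(2) by auto
next
  case (infeasible N E)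
  \<comment> \<open>The size is unchanged here; the \<open>Suc\<close> in the \<open>Inner\<close>
    clause lets the second component fall to 0.\<close>
  then show ?thesis by simp
next
  case (refine N E \<phi>' \<theta>' r)
  let ?E' = "E \<union> {\<xi>. \<exists>j < num_demos P. r j = Some \<xi>}"
  obtain j \<xi> where j: "j < num_demos P" "r j = Some \<xi>"
    using refine by blast
  then have "planner \<phi>' \<theta>' j (Some \<xi>)" using refine by metis
  then have "sat P \<xi> \<phi>' \<theta>'"
    using planner j(1) unfolding complete_planner_def counterexample_def by blast
  then have "\<xi> \<notin> E" using refine by (auto simp: learning_solution_def)
  moreover have "\<xi> \<in> ?E'" using j by blast
  \<comment> \<open>This places \<xi> in \<open>C N\<close>, hence in \<open>C N - E\<close> but not
    in \<open>C N - ?E'\<close>, which makes the inclusion strict.\<close>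
  moreover have "?E' \<subseteq> C N" using coll refine by blast
  ultimately have "C N - ?E' \<subset> C N - E" by blast
  then have "card (C N - ?E') < card (C N - E)"
    using fin by (intro psubset_card_mono) auto
  then show ?thesis using refine by simp
next
  case (accept N E \<phi>' \<theta>')
  then show ?thesis using running by blast
qed

theorem theorem1:
  fixes P :: "('x::euclidean_space, 'u, 'c::topological_space, 'p::real_vector, 'k, 'b) task"
    and planner :: "('x, 'u, 'p) planner"
    and \<phi> :: formula and \<theta> :: "nat \<Rightarrow> 'p"
    and cost_family :: "'q \<Rightarrow> ('x, 'u) traj \<Rightarrow> real" and \<theta>\<^sub>c :: 'q and \<Theta>\<^sub>c :: "'q set"
    and \<xi>_opt :: "nat \<Rightarrow> ('x, 'u) traj"
    and \<sigma> :: "nat \<Rightarrow> ('x, 'u, 'p) alg_state"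
  assumes regular: "regular_task P"
    and slack: "slack P \<ge> 0"
    and demos_feasible:
      "\<forall>j < num_demos P. sat P (demo P j) \<phi> \<theta> \<and> known_feasible P j (demo P j)"
    and demos_near_optimal:
      "\<forall>j < num_demos P. globally_optimal P j (\<xi>_opt j) \<phi> \<theta> \<and>
         cost P (demo P j) \<le> (1 + slack P) * cost P (\<xi>_opt j)"
    and A1: "complete_planner P planner"
    and A2: "\<forall>j < num_demos P. \<exists>Z s.
         labelling P \<theta> (demo P j) Z \<and> Phi Z (duration (demo P j)) \<phi> \<and>
         (\<exists>lamK lamA nu. KKT_LTL P j (demo P j) \<theta> Z s lamK lamA nu)"
    and A3: "\<theta> \<in> Theta_p P" "\<phi> \<in> Theta_s P" "cost P = cost_family \<theta>\<^sub>c" "\<theta>\<^sub>c \<in> \<Theta>\<^sub>c"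
    and exists_formula:
      "\<exists>\<phi>' \<in> Theta_s P. \<exists>\<theta>' \<in> Theta_p P. \<forall>j < num_demos P.
         sat P (demo P j) \<phi>' \<theta>' \<and> optimal_within P (slack P) j (demo P j) \<phi>' \<theta>'"
    and run: "alg_run P planner \<sigma>"
    and finitely_many: "\<forall>N. finite (collected \<sigma> N)"
  shows "\<exists>n. \<exists>\<phi>' \<in> Theta_s P. \<exists>\<theta>' \<in> Theta_p P.
           \<sigma> n = Returned \<phi>' \<theta>' \<and>
           (\<forall>j < num_demos P.
              sat P (demo P j) \<phi>' \<theta>' \<and>
              optimal_within P (slack P) j (demo P j) \<phi>' \<theta>' \<and>
              (slack P = 0 \<longrightarrow> globally_optimal P j (demo P j) \<phi>' \<theta>'))"
proof -
  have slack': "slack P > -1" using slack by simp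
  \<comment> \<open>\<open>sat\<close> demands a nonempty trajectory, which
    \<open>learning_solution\<close> does not state.\<close>
  have demo_pos: "1 \<le> duration (demo P j)" if "j < num_demos P" for j
    using demos_feasible that by (auto simp: sat_def)
  \<comment> \<open>The booleans and multipliers from \<open>A2\<close> are the witnesses, whatever
    \<open>E\<close> is.\<close>
  have feasible: "learning_solution P (dag_size \<phi>) E \<phi> \<theta>" if "\<forall>\<xi> \<in> E. \<not> sat P \<xi> \<phi> \<theta>" for E
    unfolding learning_solution_def using A2 A3(1,2) that by blast
  have not_sat: "\<not> sat P \<xi> \<phi> \<theta>"
    if "j < num_demos P" "counterexample P \<phi>' \<theta>' j \<xi>" for \<phi>' \<theta>' j \<xi>
    using counterexample_not_sat[OF slack'] demos_near_optimal that by blast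
  have sound: "sound_state P \<phi> \<theta> (\<sigma> n)" for n
  proof (induction n)
    case 0
    \<comment> \<open>The run starts at size 0, and every DAG has at least one node.\<close>
    then show ?case using run dag_size_pos by (simp add: alg_run_def)
  next
    case (Suc n)
    from run have "alg_step P planner (\<sigma> n) (\<sigma> (Suc n)) \<or> \<sigma> (Suc n) = \<sigma> n"
      by (auto simp: alg_run_def)
    then show ?case
    proof
      assume "alg_step P planner (\<sigma> n) (\<sigma> (Suc n))"
      then show ?thesis using Suc.IH A1 feasible not_sat by (rule sound_state_step)
    qed (use Suc.IH in simp)
  qed
  have "\<exists>n \<phi>' \<theta>'. \<sigma> n = Returned \<phi>' \<theta>'"
  proof (rule ccontr)
    assume running: "\<nexists>n \<phi>' \<theta>'. \<sigma> n = Returned \<phi>' \<theta>'"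
    \<comment> \<open>Taking \<open>collected \<sigma>\<close> for \<open>C\<close> gives finite
      sets that contain every \<open>E\<close> met in the inner loop, so an endless run would
      descend forever in a well-founded order.\<close>
    let ?rank = "rank (dag_size \<phi>) (collected \<sigma>)"
    have "(?rank (\<sigma> (Suc n)), ?rank (\<sigma> n)) \<in> less_than <*lex*> less_than" for n
    proof (rule rank_step)
      show "alg_step P planner (\<sigma> n) (\<sigma> (Suc n))"
        using alg_run_step[OF run A1] running by blast
      show "E \<subseteq> collected \<sigma> N" if "\<sigma> (Suc n) = Inner N E" for N E
        using that by (auto simp: collected_def)
    qed (use sound A1 finitely_many running in auto)
    then have "\<exists>f :: nat \<Rightarrow> nat \<times> nat. \<forall>n. (f (Suc n), f n) \<in> less_than <*lex*> less_than"
      by (intro exI[of _ "\<lambda>n. ?rank (\<sigma> n)"]) simp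
    moreover have "wf (less_than <*lex*> less_than)" by blast
    ultimately show False
      unfolding wf_iff_no_infinite_down_chain by blast
  qed
  then obtain n \<phi>' \<theta>' where ret: "\<sigma> n = Returned \<phi>' \<theta>'" by blast
  with sound[of n] obtain N E where sol: "learning_solution P N E \<phi>' \<theta>'"
    and none: "\<forall>j < num_demos P. \<nexists>\<xi>. counterexample P \<phi>' \<theta>' j \<xi>"
    by auto
  have "sat P (demo P j) \<phi>' \<theta>' \<and> optimal_within P (slack P) j (demo P j) \<phi>' \<theta>'"
    if "j < num_demos P" for j
  proof -
    have "sat P (demo P j) \<phi>' \<theta>'"
      using sol that demo_pos by (blast intro: learning_solution_imp_sat)
    then show ?thesis
      using optimal_within_iff_no_counterexample[OF slack'] demos_feasible none that by blast
  qed
  moreover have "\<phi>' \<in> Theta_s P" "\<theta>' \<in> Theta_p P"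
    using sol by (auto simp: learning_solution_def)
  \<comment> \<open>For slack 0 the factor \<open>1 + slack P\<close> is 1, and near-optimality
    becomes global optimality.\<close>
  ultimately show ?thesis
    using ret by (metis optimal_within_0)
qed

end
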